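(* Fix an integer $r\ge3$. For any sequence $(n_m)$ of integers with $n_m\ge2$, $$\frac{\mathcal{C}^{(n_m)}_{m,r}-\mathbb{E}(\mathcal{C}^{(n_m)}_{m,r})}{\sqrt{\mathbb{V}(\mathcal{C}^{(n_m)}_{m,r})}}\ \xrightarrow{\ d\ }\ \mathcal{N}\qquad\text{as } m\to\infty .$$
   Context: For each integer $n\ge1$, $X^{(n)}_1,X^{(n)}_2,\ldots$ is a sequence of independent random variables uniformly distributed in $\{1,\ldots,n\}$, defined on a probability space with probability $\mathbf{P}$; $\mathbb{E}$ and $\mathbb{V}$ denote expectation and variance. For $m\ge r$, $$\mathcal{C}^{(n)}_{m,r}=\sum_{1\le i_1<\cdots<i_r\le m}\mathbf{1}_{\gcd(X^{(n)}_{i_1},\ldots,X^{(n)}_{i_r})=1}$$ is the number of (mutually) coprime $r$-tuples in the sample $X^{(n)}_1,\ldots,X^{(n)}_m$. The symbol $\xrightarrow{d}$ means convergence in distribution and $\mathcal{N}$ is a standard normal variable. *)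

theory Defs
  imports "HOL-Probability.Probability"
begin

text \<open>
  \<^term>\<open>coprime_tuples r m x\<close> counts the index tuples $1 \le i_1 < \dots < i_r \le m$ with
  $\gcd(x_{i_1}, \dots, x_{i_r}) = 1$. An increasing tuple is encoded by the set
  $S = \{i_1, \dots, i_r\}$ of its entries. The count is real-valued so that it can be centered and
  scaled; it is $0$ for $m < r$.
\<close>

definition coprime_tuples :: "nat \<Rightarrow> nat \<Rightarrow> (nat \<Rightarrow> nat) \<Rightarrow> real" where
  "coprime_tuples r m x =
     (\<Sum>S | S \<subseteq> {1..m} \<and> card S = r. of_bool (Gcd (x ` S) = 1))"

definition standardized :: "'a measure \<Rightarrow> ('a \<Rightarrow> real) \<Rightarrow> 'a \<Rightarrow> real" where
  "standardized M Y \<omega> =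
     (Y \<omega> - prob_space.expectation M Y) / sqrt (prob_space.variance M Y)"

end

theory Submission
  imports Defs "HOL-Real_Asymp.Real_Asymp"
begin

text \<open>
  The count of coprime tuples is a sum over all $r$-subsets $S$ of the sample of a symmetric bounded
  kernel $k$, that is, an unnormalised U-statistic, and the proof is Hoeffding's: such a sum is
  asymptotically normal as soon as its linear part does not degenerate. Since $n$ may vary with the
  sample size, every estimate has to be uniform in the common law of the sample.

  Write $q = r - 1$. The first projection of the kernel is $h(x) = E\, k(x, X_1, \dots, X_q) - E\, k$.
  Replacing every summand by its best approximation
  $E\, k + \sum_{i \in S} h(X_i)$ splits the count into its mean, a linear part
  $L = \binom{m-1}{q} \sum_i h(X_i)$, and a remainder $R = \sum_S R_S$ (\<open>U_sum_decomposition\<close>).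
  The summand $R_S$ has mean $0$ even after any one of its variables is fixed
  (\<open>remainder_degenerate\<close>). Hence $R$ is uncorrelated with $L$, and $E\, R_S R_T = 0$ unless $S$
  and $T$ share at least two indices. Such pairs are rare by a factor of order $1/m$ compared with
  $\binom{m-1}{q}^2 m$, so $E R^2 / E L^2 = O(1/m)$ with a constant depending only on a bound
  for $k$, on $q$ and on a lower bound for $E\, h(X)^2$
  (\<open>card_pairs_sharing_two\<close>, \<open>mean_R_squared\<close>).

  Consequently the standardised sum and $L / \sqrt{E L^2}$ are $L^2$-close
  (\<open>standardization_distance\<close>), and so are their characteristic functions. The second variable
  is a normalised sum of independent bounded centred variables, and its characteristic function is
  within $O(m^{-1/2})$ of $(1 - t^2/(2m))^m$ (\<open>char_iid_sum_bound\<close>). Levy's theorem then gives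
  the general limit theorem \<open>U_statistic_clt\<close>.

  What remains is arithmetic: $E\, h(X)^2$ must stay away from $0$ for all $n \ge 2$
  (\<open>coprime_hajek_nondegenerate\<close>). For odd $x$ the values $h(x)$ and $h(2x)$ differ by the
  probability that the gcd $G$ of the other $r - 1$ entries is even and coprime to $x$. This is at
  least the probability of $G = 2$, which is bounded below because $r - 1 \ge 2$: already two
  uniform numbers have gcd $2$ with probability at least $1/36$, by $\sum_{d \ge 2} d^{-2} \le 3/4$.
  The disjoint pairs $\{x, 2x\}$ with $x \le n/2$ odd cover a fixed proportion of $\{1, \dots, n\}$.
\<close>

section \<open>Bounded functions on discrete probability spaces\<close>

abbreviation mean :: "'a pmf \<Rightarrow> ('a \<Rightarrow> real) \<Rightarrow> real" where
  "mean \<equiv> measure_pmf.expectation"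

text \<open>
  All random variables below are bounded functions on the space of a probability mass function. For
  these, integrability is automatic and iterated expectations may be exchanged freely.
\<close>

definition bdd :: "('a \<Rightarrow> real) \<Rightarrow> bool" where
  "bdd f \<longleftrightarrow> (\<exists>C. \<forall>x. \<bar>f x\<bar> \<le> C)"

lemma bddI: "(\<And>x. \<bar>f x\<bar> \<le> C) \<Longrightarrow> bdd f"
  by (auto simp: bdd_def)

lemma bdd_const: "bdd (\<lambda>_. c)"
  by (auto simp: bdd_def)

lemma bdd_compose: "bdd f \<Longrightarrow> bdd (\<lambda>x. f (g x))"
  by (auto simp: bdd_def)

lemma bdd_add: "bdd f \<Longrightarrow> bdd g \<Longrightarrow> bdd (\<lambda>x. f x + g x)"
  unfolding bdd_def by (meson abs_triangle_ineq add_mono order_trans)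

lemma bdd_mult: "bdd f \<Longrightarrow> bdd g \<Longrightarrow> bdd (\<lambda>x. f x * g x)"
  unfolding bdd_def abs_mult by (meson abs_ge_zero mult_mono order_trans)

lemma bdd_diff: "bdd f \<Longrightarrow> bdd g \<Longrightarrow> bdd (\<lambda>x. f x - g x)"
  using bdd_add[of f "\<lambda>x. (-1) * g x"] bdd_mult[OF bdd_const, of g "-1"] by simp

lemma bdd_divide: "bdd f \<Longrightarrow> bdd (\<lambda>x. f x / c)"
  using bdd_mult[OF _ bdd_const, of f "1 / c"] by simp

lemma bdd_power: "bdd f \<Longrightarrow> bdd (\<lambda>x. f x ^ n)"
  by (induction n) (auto intro: bdd_mult bdd_const)

lemma bdd_sum: "(\<And>i. i \<in> I \<Longrightarrow> bdd (f i)) \<Longrightarrow> bdd (\<lambda>x. \<Sum>i\<in>I. f i x)"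
  by (induction I rule: infinite_finite_induct) (auto intro: bdd_const bdd_add)

lemma integrable_bdd: "bdd f \<Longrightarrow> integrable (measure_pmf p) f"
  unfolding bdd_def by (elim exE, rule measure_pmf.integrable_const_bound) auto

lemma bdd_mean:
  assumes "\<And>x y. \<bar>f x y\<bar> \<le> C"
  shows "\<bar>mean q (f x)\<bar> \<le> C"
proof -
  have "\<bar>mean q (f x)\<bar> \<le> mean q (\<lambda>y. \<bar>f x y\<bar>)"
    by (rule integral_abs_bound)
  also have "\<dots> \<le> mean q (\<lambda>_. C)"
    using assms by (intro integral_mono integrable_bdd bddI[of "\<lambda>y. \<bar>f x y\<bar>" C] bdd_const) auto
  finally show ?thesis by simp
qed

lemmas bdd_intros = bdd_const bdd_add bdd_diff bdd_mult bdd_divide bdd_power bdd_sum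

lemma mean_bind_pmf:
  assumes "bdd f"
  shows "mean (bind_pmf p q) f = mean p (\<lambda>x. mean (q x) f)"
proof -
  from assms obtain C where C: "\<And>x. \<bar>f x\<bar> \<le> C" by (auto simp: bdd_def)
  show ?thesis
    unfolding measure_pmf_bind
    by (rule integral_bind[where K = "count_space UNIV" and B = C and B' = 1])
       (use C in \<open>auto intro!: measure_pmf_in_subprob_algebra AE_I2 measure_pmf.subprob_emeasure_le_1\<close>)
qed

lemma mean_pair_pmf:
  assumes "bdd f"
  shows "mean (pair_pmf p q) f = mean q (\<lambda>y. mean p (\<lambda>x. f (x, y)))"
proof -
  have "pair_pmf p q = bind_pmf q (\<lambda>y. map_pmf (\<lambda>x. (x, y)) p)"
    unfolding pair_pmf_def map_pmf_def by (rule bind_commute_pmf)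
  then show ?thesis
    using assms by (simp add: mean_bind_pmf)
qed

section \<open>Symmetric kernels and their first projection\<close>

text \<open>
  A symmetric function of finitely many arguments is the same thing as a function on multisets. With
  this encoding the law of a kernel evaluated on a subsample depends on the size of the subsample
  only: it is the image of the law of the multiset of that many independent draws.
\<close>

primrec draws :: "'a pmf \<Rightarrow> nat \<Rightarrow> 'a multiset pmf" where
  "draws p 0 = return_pmf {#}"
| "draws p (Suc n) = bind_pmf p (\<lambda>x. map_pmf (add_mset x) (draws p n))"

lemma map_image_mset_Pi_pmf:
  assumes "finite S"
  shows "map_pmf (\<lambda>x. image_mset x (mset_set S)) (Pi_pmf S d (\<lambda>_. p)) = draws p (card S)"
  using assms
proof (induction S rule: finite_induct)
  case (insert i S)
  have "image_mset (x(i := y)) (mset_set S) = image_mset x (mset_set S)" for x :: "'a \<Rightarrow> 'b" and y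
    using insert.hyps by (auto intro!: image_mset_cong)
  then show ?case
    using insert.hyps
    by (simp add: Pi_pmf_insert' map_bind_pmf flip: insert.IH)
      (simp add: map_pmf_def bind_assoc_pmf bind_return_pmf)
qed simp

lemma mean_draws_Suc:
  "bdd f \<Longrightarrow> mean (draws p (Suc n)) f = mean p (\<lambda>x. mean (draws p n) (\<lambda>M. f (add_mset x M)))"
  by (simp add: mean_bind_pmf)

text \<open>
  Integrating first over the coordinates in $A$, with those outside $A$ frozen.
\<close>

lemma mean_Pi_pmf_split:
  assumes "finite I" "A \<subseteq> I" "bdd f"
  shows "mean (Pi_pmf I d p) f =
    mean (Pi_pmf (I - A) d p) (\<lambda>y. mean (Pi_pmf A d p) (\<lambda>x. f (\<lambda>i. if i \<in> A then x i else y i)))"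
proof -
  have "Pi_pmf I d p = map_pmf (\<lambda>(f, g) x. if x \<in> A then f x else g x)
             (pair_pmf (Pi_pmf A d p) (Pi_pmf (I - A) d p))"
    using Pi_pmf_union[of A "I - A" d p] assms finite_subset by (auto simp: Un_absorb1)
  moreover have "bdd (\<lambda>z. f (\<lambda>i. if i \<in> A then fst z i else snd z i))"
    by (rule bdd_compose[OF assms(3)])
  ultimately show ?thesis
    by (simp add: mean_pair_pmf case_prod_unfold cong: if_cong)
qed

text \<open>
  The source of all orthogonality relations: if \<open>u\<close> averages to $0$ over the coordinates in $A$
  whatever the other coordinates are, it is uncorrelated with everything that does not depend on
  the coordinates in $A$.
\<close>

lemma mean_mult_eq_0:
  assumes "finite I" "A \<subseteq> I" "bdd u" "bdd v"
    and v: "\<And>x y. (\<And>i. i \<notin> A \<Longrightarrow> x i = y i) \<Longrightarrow> v x = v y"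
    and u: "\<And>y. mean (Pi_pmf A d p) (\<lambda>x. u (\<lambda>i. if i \<in> A then x i else y i)) = 0"
  shows "mean (Pi_pmf I d p) (\<lambda>x. u x * v x) = 0"
proof -
  have *: "v (\<lambda>i. if i \<in> A then x i else y i) = v y" for x y
    by (rule v) simp
  show ?thesis
    by (subst mean_Pi_pmf_split[OF assms(1,2) bdd_mult[OF assms(3,4)]]) (simp add: * u)
qed

lemma mean_Pi_pmf_component:
  "finite I \<Longrightarrow> i \<in> I \<Longrightarrow> mean (Pi_pmf I d (\<lambda>_. p)) (\<lambda>x. h (x i)) = mean p h"
  by (subst integral_map_pmf[symmetric, where f = h]) (simp add: Pi_pmf_component)

text \<open>
  The centred first projection of a kernel of $q + 1$ arguments: the effect on the mean of the kernel
  of fixing one argument.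
\<close>

definition hajek :: "'a pmf \<Rightarrow> ('a multiset \<Rightarrow> real) \<Rightarrow> nat \<Rightarrow> 'a \<Rightarrow> real" where
  "hajek p k q x = mean (draws p q) (\<lambda>M. k (add_mset x M)) - mean (draws p (Suc q)) k"

lemma abs_hajek_le:
  assumes "\<And>M. \<bar>k M\<bar> \<le> B"
  shows "\<bar>hajek p k q x\<bar> \<le> 2 * B"
proof -
  have "\<bar>mean (draws p q) (\<lambda>M. k (add_mset x M))\<bar> \<le> B" "\<bar>mean (draws p (Suc q)) k\<bar> \<le> B"
    using bdd_mean[of "\<lambda>_ M. k M" B] bdd_mean[of "\<lambda>x M. k (add_mset x M)" B] assms by auto
  then show ?thesis
    unfolding hajek_def by linarith
qed

lemma bdd_hajek: "bdd k \<Longrightarrow> bdd (hajek p k q)"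
  unfolding bdd_def by (meson abs_hajek_le)

text \<open>
  The first of $q + 1$ draws averages the conditional mean of the kernel to its mean.
\<close>

lemma mean_hajek: "bdd k \<Longrightarrow> mean p (hajek p k q) = 0"
proof -
  assume k: "bdd k"
  then obtain B where "\<And>M. \<bar>k M\<bar> \<le> B" by (auto simp: bdd_def)
  then have "bdd (\<lambda>x. mean (draws p q) (\<lambda>M. k (add_mset x M)))"
    by (intro bddI[of _ B] bdd_mean)
  then show ?thesis
    unfolding hajek_def mean_draws_Suc[OF k]
    by (subst Bochner_Integration.integral_diff) (simp_all add: integrable_bdd)
qed

text \<open>
  What is left of the kernel on the subsample $S$ after removing its affine approximation, the part
  of order at least two in its Hoeffding decomposition.
\<close>

definition remainder :: "'a pmf \<Rightarrow> ('a multiset \<Rightarrow> real) \<Rightarrow> nat \<Rightarrow> 'i set \<Rightarrow> ('i \<Rightarrow> 'a) \<Rightarrow> real" where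
  "remainder p k q S x =
     k (image_mset x (mset_set S)) - mean (draws p (Suc q)) k - (\<Sum>i\<in>S. hajek p k q (x i))"

lemma bdd_remainder:
  assumes "bdd k"
  shows "bdd (remainder p k q S)"
  unfolding remainder_def[abs_def]
  by (intro bdd_intros bdd_compose[OF assms] bdd_compose[OF bdd_hajek[OF assms]])

lemma remainder_cong: "(\<And>i. i \<in> S \<Longrightarrow> x i = y i) \<Longrightarrow> remainder p k q S x = remainder p k q S y"
proof -
  assume *: "\<And>i. i \<in> S \<Longrightarrow> x i = y i"
  then have "image_mset x (mset_set S) = image_mset y (mset_set S)"
    by (cases "finite S") (auto intro!: image_mset_cong)
  with * show ?thesis by (simp add: remainder_def)
qed

lemma abs_remainder_le:
  assumes "\<And>M. \<bar>k M\<bar> \<le> B"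
  shows "\<bar>remainder p k q S x\<bar> \<le> 2 * B * (1 + card S)"
proof -
  have "\<bar>\<Sum>i\<in>S. hajek p k q (x i)\<bar> \<le> (\<Sum>i\<in>S. 2 * B)"
    by (intro order.trans[OF sum_abs] sum_mono abs_hajek_le assms)
  moreover have "\<bar>mean (draws p (Suc q)) k\<bar> \<le> B"
    using bdd_mean[of "\<lambda>_ M. k M" B] assms by auto
  moreover have "\<bar>k (image_mset x (mset_set S))\<bar> \<le> B" by fact
  ultimately show ?thesis
    unfolding remainder_def by (simp add: algebra_simps)
qed

text \<open>
  Fix the variable $y_i$ and average over the others. The kernel contributes its conditional mean
  $E\,k + h(y_i)$, which the terms $E\,k$ and $h(y_i)$ cancel, and the other terms $h(x_j)$ have mean $0$.
\<close>

lemma remainder_degenerate: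
  assumes k: "bdd k" and S: "finite S" "card S = Suc q" "i \<in> S"
  shows "mean (Pi_pmf (S - {i}) d (\<lambda>_. p))
    (\<lambda>x. remainder p k q S (\<lambda>j. if j \<in> S - {i} then x j else y j)) = 0"
proof -
  let ?P = "Pi_pmf (S - {i}) d (\<lambda>_. p)"
  let ?h = "hajek p k q"
  have ms: "mset_set S = add_mset i (mset_set (S - {i}))"
    using S by (metis mset_set.remove)
  have im: "image_mset (\<lambda>j. if j \<in> S - {i} then x j else y j) (mset_set S) =
    add_mset (y i) (image_mset x (mset_set (S - {i})))" for x
    using S by (auto simp: ms intro!: image_mset_cong)
  have sm: "(\<Sum>j\<in>S. ?h (if j \<in> S - {i} then x j else y j)) = ?h (y i) + (\<Sum>j\<in>S-{i}. ?h (x j))" for x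
    using S by (subst sum.remove[of S i]) (auto intro!: sum.cong)
  have bh: "bdd (\<lambda>x. ?h (x j))" for j :: 'b
    by (rule bdd_compose[OF bdd_hajek[OF k]])
  have "mean ?P (\<lambda>x. k (add_mset (y i) (image_mset x (mset_set (S - {i}))))) =
      mean (map_pmf (\<lambda>x. image_mset x (mset_set (S - {i}))) ?P) (\<lambda>M. k (add_mset (y i) M))"
    by simp
  also have "\<dots> = mean (draws p q) (\<lambda>M. k (add_mset (y i) M))"
    using S by (subst map_image_mset_Pi_pmf) auto
  also have "\<dots> = ?h (y i) + mean (draws p (Suc q)) k"
    by (simp add: hajek_def)
  finally have 1: "mean ?P (\<lambda>x. k (add_mset (y i) (image_mset x (mset_set (S - {i}))))) = \<dots>" .
  have 2: "mean ?P (\<lambda>x. \<Sum>j\<in>S-{i}. ?h (x j)) = 0"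
    using S k by (subst Bochner_Integration.integral_sum)
      (auto simp: integrable_bdd[OF bh] mean_Pi_pmf_component mean_hajek intro!: sum.neutral)
  have ik: "integrable ?P (\<lambda>x. k (add_mset (y i) (image_mset x (mset_set (S - {i})))))"
    by (intro integrable_bdd bdd_compose[OF k])
  have iR: "integrable ?P (\<lambda>x. \<Sum>j\<in>S-{i}. ?h (x j))"
    by (intro integrable_bdd bdd_sum bh)
  show ?thesis
    unfolding remainder_def im sm using ik iR 1 2 by simp
qed

section \<open>Second moments of U-statistics\<close>

text \<open>
  A U-statistic without its normalising factor.
\<close>

definition U_sum :: "('a multiset \<Rightarrow> real) \<Rightarrow> nat \<Rightarrow> 'i set \<Rightarrow> ('i \<Rightarrow> 'a) \<Rightarrow> real" where
  "U_sum k r I x = (\<Sum>S | S \<subseteq> I \<and> card S = r. k (image_mset x (mset_set S)))"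

text \<open>
  Removing $P$ maps these sets bijectively to the subsets of size $j$ of the complement of $P$.
\<close>

lemma card_subsets_containing:
  assumes "finite I" "P \<subseteq> I"
  shows "card {S. S \<subseteq> I \<and> card S = card P + j \<and> P \<subseteq> S} = (card I - card P) choose j"
proof -
  have fP: "finite P" using assms finite_subset by blast
  have "bij_betw (\<lambda>T. P \<union> T) {T. T \<subseteq> I - P \<and> card T = j} {S. S \<subseteq> I \<and> card S = card P + j \<and> P \<subseteq> S}"
  proof (rule bij_betwI[where g = "\<lambda>S. S - P"])
    show "(\<lambda>T. P \<union> T) \<in> {T. T \<subseteq> I - P \<and> card T = j} \<rightarrow> {S. S \<subseteq> I \<and> card S = card P + j \<and> P \<subseteq> S}"
      using assms fP by (auto intro!: card_Un_disjoint intro: finite_subset[OF _ assms(1)])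
    show "(\<lambda>S. S - P) \<in> {S. S \<subseteq> I \<and> card S = card P + j \<and> P \<subseteq> S} \<rightarrow> {T. T \<subseteq> I - P \<and> card T = j}"
      using fP by (auto simp: card_Diff_subset)
  qed auto
  then have "card {S. S \<subseteq> I \<and> card S = card P + j \<and> P \<subseteq> S} = card {T. T \<subseteq> I - P \<and> card T = j}"
    by (simp add: bij_betw_same_card)
  also have "\<dots> = card (I - P) choose j"
    using assms by (intro n_subsets) auto
  finally show ?thesis
    using assms fP by (simp add: card_Diff_subset)
qed

text \<open>
  Each index lies in $\binom{|I| - 1}{q}$ of the sets.
\<close>

lemma sum_subsets_sum_elements:
  fixes f :: "'i \<Rightarrow> real"
  assumes "finite I"
  shows "(\<Sum>S | S \<subseteq> I \<and> card S = Suc q. \<Sum>i\<in>S. f i) = real ((card I - 1) choose q) * (\<Sum>i\<in>I. f i)"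
proof -
  let ?F = "{S. S \<subseteq> I \<and> card S = Suc q}"
  have fin: "finite ?F" using assms by simp
  have "(\<Sum>i\<in>S. f i) = (\<Sum>i\<in>I. if i \<in> S then f i else 0)" if "S \<in> ?F" for S
    using that assms by (simp add: sum.inter_restrict[symmetric] Int_absorb1)
  then have "(\<Sum>S\<in>?F. \<Sum>i\<in>S. f i) = (\<Sum>S\<in>?F. \<Sum>i\<in>I. if i \<in> S then f i else 0)"
    by (rule sum.cong[OF refl])
  also have "\<dots> = (\<Sum>i\<in>I. \<Sum>S\<in>?F. if i \<in> S then f i else 0)"
    by (rule sum.swap)
  also have "\<dots> = (\<Sum>i\<in>I. real ((card I - 1) choose q) * f i)"
  proof (rule sum.cong[OF refl])
    fix i assume "i \<in> I"
    have "(\<Sum>S\<in>?F. if i \<in> S then f i else 0) = real (card {S. S \<subseteq> I \<and> card S = card {i} + q \<and> {i} \<subseteq> S}) * f i"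
      unfolding sum.inter_filter[OF fin, symmetric] by (simp add: conj_assoc)
    also have "\<dots> = real ((card I - 1) choose q) * f i"
      using card_subsets_containing[OF assms, of "{i}" q] \<open>i \<in> I\<close> by simp
    finally show "(\<Sum>S\<in>?F. if i \<in> S then f i else 0) = \<dots>" .
  qed
  finally show ?thesis by (simp add: sum_distrib_left)
qed

lemma U_sum_decomposition:
  assumes "finite I"
  shows "U_sum k (Suc q) I x =
    real (card I choose Suc q) * mean (draws p (Suc q)) k
    + real ((card I - 1) choose q) * (\<Sum>i\<in>I. hajek p k q (x i))
    + (\<Sum>S | S \<subseteq> I \<and> card S = Suc q. remainder p k q S x)"
proof -
  let ?F = "{S. S \<subseteq> I \<and> card S = Suc q}"
  have "U_sum k (Suc q) I x = (\<Sum>S\<in>?F. mean (draws p (Suc q)) k + (\<Sum>i\<in>S. hajek p k q (x i)) + remainder p k q S x)"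
    unfolding U_sum_def by (intro sum.cong refl) (simp add: remainder_def)
  also have "\<dots> = real (card ?F) * mean (draws p (Suc q)) k + (\<Sum>S\<in>?F. \<Sum>i\<in>S. hajek p k q (x i)) + (\<Sum>S\<in>?F. remainder p k q S x)"
    by (simp add: sum.distrib)
  finally show ?thesis
    using assms by (simp add: sum_subsets_sum_elements n_subsets)
qed

text \<open>
  A pair $(S, T)$ with $|S \cap T| \ge 2$ is counted at least once when one sums over all two-element
  sets $P$ the number of pairs with $P \subseteq S$ and $P \subseteq T$. This gives the upper bound
  $\binom{m}{2} \binom{m-2}{q-1}^2$, and the absorption identity expresses it through the factor
  $\binom{m-1}{q}^2 m$ that appears in the second moment of the linear part. What counts is the gain
  $1/(m - 1)$.
\<close>

lemma card_pairs_sharing_two: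
  fixes I :: "'i set" and q :: nat
  assumes "finite I" "card I \<ge> 2"
  defines "F \<equiv> {S. S \<subseteq> I \<and> card S = Suc q}"
  shows "(\<Sum>S\<in>F. \<Sum>T\<in>F. of_bool (card (S \<inter> T) \<ge> 2)) \<le>
    (real q)\<^sup>2 / (2 * (real (card I) - 1)) * ((real ((card I - 1) choose q))\<^sup>2 * real (card I))"
proof (cases "q = 0")
  case True
  have *: "\<not> 2 \<le> card (S \<inter> T)" if "S \<in> F" for S T
    using that True card_mono[of S "S \<inter> T"] finite_subset[OF _ assms(1)] by (auto simp: F_def)
  have "(\<Sum>S\<in>F. \<Sum>T\<in>F. of_bool (card (S \<inter> T) \<ge> 2) :: real) = 0"
    by (intro sum.neutral ballI) (simp add: *)
  with True show ?thesis by simp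
next
  case False
  let ?m = "card I"
  define D where "D = {P. P \<subseteq> I \<and> card P = 2}"
  define b where "b = real ((?m - 2) choose (q - 1))"
  define a where "a = real ((?m - 1) choose q)"
  have fin: "finite F" "finite D" unfolding F_def D_def using assms by simp_all
  have "of_bool (card (S \<inter> T) \<ge> 2) \<le> (\<Sum>P\<in>D. of_bool (P \<subseteq> S) * of_bool (P \<subseteq> T) :: real)"
    if "S \<in> F" "T \<in> F" for S T
  proof (cases "card (S \<inter> T) \<ge> 2")
    case True
    then obtain P where "P \<subseteq> S \<inter> T" "card P = 2" by (elim obtain_subset_with_card_n)
    moreover from this have "P \<in> D" using that by (auto simp: D_def F_def)
    ultimately have "P \<in> D" and "(1::real) \<le> of_bool (P \<subseteq> S) * of_bool (P \<subseteq> T)" by auto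
    note this(2)
    also have "of_bool (P \<subseteq> S) * of_bool (P \<subseteq> T) \<le> (\<Sum>P\<in>D. of_bool (P \<subseteq> S) * of_bool (P \<subseteq> T) :: real)"
      using fin \<open>P \<in> D\<close> by (intro member_le_sum) auto
    finally show ?thesis by simp
  next
    case False
    then show ?thesis by (simp add: sum_nonneg)
  qed
  then have "(\<Sum>S\<in>F. \<Sum>T\<in>F. of_bool (card (S \<inter> T) \<ge> 2)) \<le>
     (\<Sum>S\<in>F. \<Sum>T\<in>F. \<Sum>P\<in>D. of_bool (P \<subseteq> S) * of_bool (P \<subseteq> T) :: real)"
    by (intro sum_mono) auto
  also have "\<dots> = (\<Sum>P\<in>D. \<Sum>S\<in>F. \<Sum>T\<in>F. of_bool (P \<subseteq> S) * of_bool (P \<subseteq> T))"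
    by (simp only: sum.swap[of _ F D])
  also have "\<dots> = (\<Sum>P\<in>D. (\<Sum>S\<in>F. of_bool (P \<subseteq> S))\<^sup>2)"
    by (simp only: sum_product power2_eq_square)
  also have "\<dots> = (\<Sum>P\<in>D. b\<^sup>2)"
  proof (rule sum.cong[OF refl])
    fix P assume P: "P \<in> D"
    have "(\<Sum>S\<in>F. of_bool (P \<subseteq> S) :: real) = card {S. S \<subseteq> I \<and> card S = card P + (q - 1) \<and> P \<subseteq> S}"
      using fin P False by (simp add: of_bool_def sum.If_cases F_def D_def Int_def conj_assoc)
    also have "\<dots> = b"
      using card_subsets_containing[OF assms(1), of P "q - 1"] P by (simp add: b_def D_def)
    finally show "(\<Sum>S\<in>F. of_bool (P \<subseteq> S) :: real)\<^sup>2 = b\<^sup>2" by simp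
  qed
  also have "\<dots> = real (?m choose 2) * b\<^sup>2"
    using n_subsets[OF assms(1), of 2] by (simp add: D_def)
  also have "real (?m choose 2) = real ?m * (real ?m - 1) / 2"
    by (simp add: choose_two real_of_nat_div algebra_simps of_nat_diff)
  \<comment> \<open>absorption identity, comparing sets through two points with sets through one\<close>
  also have "b = q * a / (real ?m - 1)"
  proof -
    have "q * ((?m - 1) choose q) = (?m - 1) * ((?m - 2) choose (q - 1))"
      using binomial_absorption[of "q - 1" "?m - 1"] False by (simp add: numeral_2_eq_2)
    then have "real q * a = real (?m - 1) * b"
      unfolding a_def b_def of_nat_mult[symmetric] by (rule arg_cong)
    then have "real q * a = (real ?m - 1) * b"
      using assms(2) by (simp add: of_nat_diff)
    then show ?thesis using assms(2) by (simp add: field_simps)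
  qed
  also have "real ?m * (real ?m - 1) / 2 * (q * a / (real ?m - 1))\<^sup>2 =
     (real q)\<^sup>2 / (2 * (real ?m - 1)) * (a\<^sup>2 * real ?m)"
  proof -
    have "x * y / 2 * (z * a / y)\<^sup>2 = z\<^sup>2 / (2 * y) * (a\<^sup>2 * x)" if "y \<noteq> 0" for x y z :: real
      using that by (simp add: power2_eq_square)
    then show ?thesis
      using assms(2) by auto
  qed
  finally show ?thesis unfolding a_def .
qed

text \<open>
  The decomposition of a U-statistic of $q + 1$ arguments on a sample indexed by $I$ into its mean
  \<open>\<theta>\<close>, its linear part \<open>L\<close> and its degenerate part \<open>R\<close>. The number \<open>\<zeta>\<close> is the variance of the
  first projection of the kernel.
\<close>

locale bounded_kernel =
  fixes p :: "'a pmf" and k :: "'a multiset \<Rightarrow> real" and B :: real and q :: nat and I :: "'i set" and d :: 'a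
  assumes kernel_bound: "\<bar>k M\<bar> \<le> B" and fin: "finite I"
begin

abbreviation "sample \<equiv> Pi_pmf I d (\<lambda>_. p)"
abbreviation "h \<equiv> hajek p k q"
definition "F = {S. S \<subseteq> I \<and> card S = Suc q}"
definition "L x = real ((card I - 1) choose q) * (\<Sum>i\<in>I. h (x i))"
definition "R x = (\<Sum>S\<in>F. remainder p k q S x)"
definition "\<theta> = real (card I choose Suc q) * mean (draws p (Suc q)) k"
definition "\<zeta> = mean p (\<lambda>x. (h x)\<^sup>2)"

lemma bdd_k: "bdd k" using kernel_bound by (rule bddI)

lemma bdd_h: "bdd (\<lambda>x. h (x i))"
  by (rule bdd_compose[OF bdd_hajek[OF bdd_k]])

lemma bdd_L: "bdd L"
  unfolding L_def[abs_def] by (intro bdd_intros bdd_h)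

lemma bdd_R: "bdd R"
  unfolding R_def[abs_def] by (intro bdd_intros bdd_remainder bdd_k)

lemma U_sum_eq: "U_sum k (Suc q) I x = \<theta> + L x + R x"
  unfolding \<theta>_def L_def R_def F_def by (rule U_sum_decomposition[OF fin])

lemma mem_F: "S \<in> F \<Longrightarrow> finite S \<and> S \<subseteq> I \<and> card S = Suc q \<and> S \<noteq> {}"
  using fin finite_subset by (auto simp: F_def)

text \<open>
  Degeneracy as orthogonality: a remainder is uncorrelated with every variable that shares at most
  the coordinate $i$ with it.
\<close>

lemma mean_remainder_mult:
  assumes S: "S \<in> F" "i \<in> S" and v: "bdd v" "\<And>x y. (\<And>j. j \<notin> S - {i} \<Longrightarrow> x j = y j) \<Longrightarrow> v x = v y"
  shows "mean sample (\<lambda>x. remainder p k q S x * v x) = 0"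
proof (rule mean_mult_eq_0[where A = "S - {i}"])
  show "mean (Pi_pmf (S - {i}) d (\<lambda>_. p))
     (\<lambda>x. remainder p k q S (\<lambda>j. if j \<in> S - {i} then x j else y j)) = 0" for y
    using mem_F[OF S(1)] S(2) by (intro remainder_degenerate bdd_k) auto
  show "v x = v y" if "\<And>j. j \<notin> S - {i} \<Longrightarrow> x j = y j" for x y
    using that by (rule v(2))
  show "S - {i} \<subseteq> I" using mem_F[OF S(1)] by blast
qed (fact fin bdd_remainder[OF bdd_k] v(1))+

lemma mean_remainder: "S \<in> F \<Longrightarrow> mean sample (remainder p k q S) = 0"
  using mean_remainder_mult[OF _ _ bdd_const[of 1] refl, of S] mem_F[of S] by auto

lemma mean_R: "mean sample R = 0"
  unfolding R_def[abs_def]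
  by (subst Bochner_Integration.integral_sum)
    (simp_all add: integrable_bdd bdd_remainder bdd_k mean_remainder)

lemma mean_h: "i \<in> I \<Longrightarrow> mean sample (\<lambda>x. h (x i)) = 0"
  by (simp add: mean_Pi_pmf_component[OF fin] mean_hajek bdd_k)

lemma mean_L: "mean sample L = 0"
  unfolding L_def[abs_def] by (simp add: integrable_bdd bdd_h mean_h)

lemma mean_h_mult:
  assumes "i \<in> I" "j \<in> I"
  shows "mean sample (\<lambda>x. h (x i) * h (x j)) = (if i = j then \<zeta> else 0)"
proof (cases "i = j")
  case True
  then show ?thesis
    using mean_Pi_pmf_component[OF fin assms(1), of d p "\<lambda>x. (h x)\<^sup>2"] by (simp add: \<zeta>_def power2_eq_square)
next
  case False
  have "mean sample (\<lambda>x. h (x i) * h (x j)) = 0"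
  proof (rule mean_mult_eq_0[where A = "{i}"])
    show "mean (Pi_pmf {i} d (\<lambda>_. p)) (\<lambda>x. h (if i \<in> {i} then x i else y i)) = 0" for y :: "'i \<Rightarrow> 'a"
      by (simp add: mean_Pi_pmf_component mean_hajek bdd_k)
  qed (use assms fin False bdd_h in auto)
  with False show ?thesis by simp
qed

lemma mean_L_squared: "mean sample (\<lambda>x. (L x)\<^sup>2) = (real ((card I - 1) choose q))\<^sup>2 * card I * \<zeta>"
proof -
  have "(\<lambda>x. (L x)\<^sup>2) = (\<lambda>x. (real ((card I - 1) choose q))\<^sup>2 * (\<Sum>i\<in>I. \<Sum>j\<in>I. h (x i) * h (x j)))"
    by (simp only: L_def power_mult_distrib) (simp only: power2_eq_square sum_product)
  moreover have "mean sample (\<lambda>x. \<Sum>i\<in>I. \<Sum>j\<in>I. h (x i) * h (x j)) = (\<Sum>i\<in>I. \<Sum>j\<in>I. if i = j then \<zeta> else 0)"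
    by (simp add: integrable_bdd bdd_mult bdd_sum bdd_h mean_h_mult)
  ultimately show ?thesis using fin by simp
qed

text \<open>
  A single observation never shares more than one coordinate with a remainder.
\<close>

lemma mean_remainder_h:
  assumes "S \<in> F" "i \<in> I"
  shows "mean sample (\<lambda>x. remainder p k q S x * h (x i)) = 0"
proof -
  obtain j where "j \<in> S" "i \<notin> S - {j}" 
    using mem_F[OF assms(1)] by (cases "i \<in> S") auto
  then show ?thesis
    using assms bdd_h by (intro mean_remainder_mult[where i = j]) auto
qed

lemma mean_R_L: "mean sample (\<lambda>x. L x * R x) = 0"
proof -
  have "(\<lambda>x. L x * R x) = (\<lambda>x. real ((card I - 1) choose q) * (\<Sum>i\<in>I. \<Sum>S\<in>F. remainder p k q S x * h (x i)))"
    by (simp add: L_def R_def sum_product mult.assoc mult.commute[of "h _"])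
  moreover have "mean sample (\<lambda>x. \<Sum>i\<in>I. \<Sum>S\<in>F. remainder p k q S x * h (x i)) = 0"
    by (simp add: integrable_bdd bdd_mult bdd_sum bdd_h bdd_remainder bdd_k mean_remainder_h)
  ultimately show ?thesis by simp
qed

text \<open>
  If $S \cap T \subseteq \{i\}$ for some $i \in S$, then the two remainders are orthogonal. Otherwise
  the bound is the trivial one.
\<close>

lemma mean_remainder_remainder:
  assumes "S \<in> F" "T \<in> F"
  shows "mean sample (\<lambda>x. remainder p k q S x * remainder p k q T x) \<le>
    (2 * B * (q + 2))\<^sup>2 * of_bool (card (S \<inter> T) \<ge> 2)"
proof (cases "card (S \<inter> T) \<ge> 2")
  case True
  have *: "\<bar>remainder p k q S x\<bar> \<le> 2 * B * (q + 2)" if "S \<in> F" for S x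
    using abs_remainder_le[where k = k and B = B and p = p and q = q and S = S and x = x] kernel_bound mem_F[OF that] by (simp add: algebra_simps)
  have "remainder p k q S x * remainder p k q T x \<le> (2 * B * (q + 2))\<^sup>2" for x
  proof -
    have "remainder p k q S x * remainder p k q T x \<le> \<bar>remainder p k q S x\<bar> * \<bar>remainder p k q T x\<bar>"
      by (simp flip: abs_mult)
    also have "\<dots> \<le> (2 * B * (q + 2)) * (2 * B * (q + 2))"
      using *[OF assms(1), of x] *[OF assms(2), of x] by (intro mult_mono) auto
    finally show ?thesis by (simp add: power2_eq_square)
  qed
  then have "mean sample (\<lambda>x. remainder p k q S x * remainder p k q T x) \<le> mean sample (\<lambda>x. (2 * B * (q + 2))\<^sup>2)"
    by (intro integral_mono integrable_bdd bdd_mult bdd_remainder bdd_k bdd_const)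
  then show ?thesis using True by simp
next
  case False
  have "finite (S \<inter> T)" using mem_F assms by blast
  obtain i where i: "i \<in> S" "S \<inter> T \<subseteq> {i}"
  proof (cases "S \<inter> T = {}")
    case True
    then show ?thesis using that mem_F[OF assms(1)] by blast
  next
    case ne: False
    then have "card (S \<inter> T) = 1" 
      using False \<open>finite (S \<inter> T)\<close> card_gt_0_iff[of "S \<inter> T"] by linarith
    then show ?thesis using that by (auto simp: card_1_singleton_iff)
  qed
  have "mean sample (\<lambda>x. remainder p k q S x * remainder p k q T x) = 0"
    using assms i by (intro mean_remainder_mult[where i = i] bdd_remainder bdd_k remainder_cong) auto
  with False show ?thesis by simp
qed

lemma mean_R_squared:
  assumes "card I \<ge> 2"
  shows "mean sample (\<lambda>x. (R x)\<^sup>2) \<le>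
    (2 * B * (q + 2) * q)\<^sup>2 / (2 * (real (card I) - 1)) * ((real ((card I - 1) choose q))\<^sup>2 * card I)"
proof -
  have "mean sample (\<lambda>x. (R x)\<^sup>2) = (\<Sum>S\<in>F. \<Sum>T\<in>F. mean sample (\<lambda>x. remainder p k q S x * remainder p k q T x))"
    by (simp add: R_def power2_eq_square sum_product integrable_bdd bdd_mult bdd_sum bdd_remainder bdd_k)
  also have "\<dots> \<le> (\<Sum>S\<in>F. \<Sum>T\<in>F. (2 * B * (q + 2))\<^sup>2 * of_bool (card (S \<inter> T) \<ge> 2))"
    by (intro sum_mono mean_remainder_remainder)
  also have "\<dots> = (2 * B * (q + 2))\<^sup>2 * (\<Sum>S\<in>F. \<Sum>T\<in>F. of_bool (card (S \<inter> T) \<ge> 2))"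
    by (simp only: sum_distrib_left)
  also have "\<dots> \<le> (2 * B * (q + 2))\<^sup>2 * ((real q)\<^sup>2 / (2 * (real (card I) - 1)) * ((real ((card I - 1) choose q))\<^sup>2 * real (card I)))"
    using card_pairs_sharing_two[OF fin assms] by (intro mult_left_mono) (auto simp: F_def)
  finally show ?thesis by (simp only: power_mult_distrib times_divide_eq_left times_divide_eq_right ac_simps)
qed

end

section \<open>The central limit theorem for U-statistics with bounded kernels\<close>

text \<open>
  A quantitative central limit theorem. It is the classical argument (expand the characteristic
  function of one summand to second order, then compare $m$-th powers of complex numbers in the unit
  disc), but with an error that depends on the law of the summands only through the bound $C$ and
  the variance \<open>\<zeta>\<close>. This makes it applicable when the law changes with the number of summands.
\<close>

lemma char_iid_sum_bound:
  fixes h :: "'a \<Rightarrow> real" and t :: real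
  assumes h: "\<And>x. \<bar>h x\<bar> \<le> C" "mean p h = 0" "mean p (\<lambda>x. (h x)\<^sup>2) = \<zeta>" "\<zeta> > 0"
    and I: "finite I" "I \<noteq> {}" "t\<^sup>2 / 4 \<le> real (card I)"
  shows "cmod (char (distr (measure_pmf (Pi_pmf I d (\<lambda>_. p))) borel (\<lambda>x. (\<Sum>i\<in>I. h (x i)) / sqrt (real (card I) * \<zeta>))) t
      - complex_of_real ((1 + (-(t\<^sup>2) / 2) / real (card I)) ^ card I))
    \<le> \<bar>t\<bar> ^ 3 * C / (6 * sqrt (real (card I) * \<zeta>))"
proof -
  let ?P = "Pi_pmf I d (\<lambda>_. p)"
  define m where "m = card I"
  have m: "m > 0" using I by (simp add: m_def card_gt_0_iff)
  define s where "s = sqrt (real m * \<zeta>)"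
  have s: "s > 0" "s\<^sup>2 = real m * \<zeta>" using m h by (auto simp: s_def)
  have bh: "bdd h" using h(1) by (rule bddI)
  have C: "C \<ge> 0" using h(1)[of undefined] by linarith
  define \<phi> where "\<phi> = char (distr (measure_pmf p) borel h) (t / s)"
  define \<psi> where "\<psi> = complex_of_real (1 + (-(t\<^sup>2) / 2) / real m)"
  have ind: "prob_space.indep_vars (measure_pmf ?P) (\<lambda>_. borel) (\<lambda>i x. h (x i) / s) I"
    by (rule prob_space.indep_vars_compose2[OF measure_pmf.prob_space_axioms indep_vars_Pi_pmf[OF I(1)]]) simp
  have comp: "char (distr (measure_pmf ?P) borel (\<lambda>x. h (x i) / s)) t = \<phi>" if "i \<in> I" for i
  proof -
    have "char (distr (measure_pmf ?P) borel (\<lambda>x. h (x i) / s)) t = (\<integral>x. iexp (t * (h (x i) / s)) \<partial>measure_pmf ?P)"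
      by (simp add: char_def integral_distr)
    also have "\<dots> = (\<integral>y. iexp (t * (h y / s)) \<partial>measure_pmf (map_pmf (\<lambda>x. x i) ?P))"
      by simp
    also have "map_pmf (\<lambda>x. x i) ?P = p"
      using I that by (simp add: Pi_pmf_component)
    finally show ?thesis
      by (simp add: \<phi>_def char_def integral_distr)
  qed
  have "char (distr (measure_pmf ?P) borel (\<lambda>x. (\<Sum>i\<in>I. h (x i)) / s)) t = char (distr (measure_pmf ?P) borel (\<lambda>x. \<Sum>i\<in>I. h (x i) / s)) t"
    by (simp add: sum_divide_distrib)
  also have "\<dots> = (\<Prod>i\<in>I. char (distr (measure_pmf ?P) borel (\<lambda>x. h (x i) / s)) t)"
    by (rule prob_space.char_distr_sum[OF measure_pmf.prob_space_axioms ind])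
  also have "\<dots> = \<phi> ^ m"
    by (simp add: comp m_def)
  finally have eq: "char (distr (measure_pmf ?P) borel (\<lambda>x. (\<Sum>i\<in>I. h (x i)) / s)) t = \<phi> ^ m" .

  have int: "integrable (measure_pmf p) h" "integrable (measure_pmf p) (\<lambda>x. (h x)\<^sup>2)"
    by (intro integrable_bdd bdd_power bh)+
  have var: "measure_pmf.variance p h = \<zeta>" using h by simp
  \<comment> \<open>boundedness trades one factor of the third moment for C\<close>
  have min: "mean p (\<lambda>x. min (6 * (h x)\<^sup>2) (\<bar>t / s\<bar> * \<bar>h x\<bar> ^ 3)) \<le> \<bar>t / s\<bar> * C * \<zeta>"
  proof -
    have "mean p (\<lambda>x. min (6 * (h x)\<^sup>2) (\<bar>t / s\<bar> * \<bar>h x\<bar> ^ 3)) \<le> mean p (\<lambda>x. \<bar>t / s\<bar> * C * (h x)\<^sup>2)"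
    proof (intro integral_mono)
      have "bdd (\<lambda>x. min (6 * (h x)\<^sup>2) (\<bar>t / s\<bar> * \<bar>h x\<bar> ^ 3))"
      proof (rule bddI)
        fix x
        have "\<bar>min (6 * (h x)\<^sup>2) (\<bar>t / s\<bar> * \<bar>h x\<bar> ^ 3)\<bar> \<le> 6 * \<bar>h x\<bar>\<^sup>2"
          by simp
        also have "\<dots> \<le> 6 * C\<^sup>2" using h(1)[of x] by (intro mult_left_mono power_mono) auto
        finally show "\<bar>min (6 * (h x)\<^sup>2) (\<bar>t / s\<bar> * \<bar>h x\<bar> ^ 3)\<bar> \<le> 6 * C\<^sup>2" .
      qed
      then show "integrable (measure_pmf p) (\<lambda>x. min (6 * (h x)\<^sup>2) (\<bar>t / s\<bar> * \<bar>h x\<bar> ^ 3))"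
        by (rule integrable_bdd)
      show "min (6 * (h x)\<^sup>2) (\<bar>t / s\<bar> * \<bar>h x\<bar> ^ 3) \<le> \<bar>t / s\<bar> * C * (h x)\<^sup>2" for x
      proof -
        have "\<bar>t / s\<bar> * \<bar>h x\<bar> ^ 3 = \<bar>t / s\<bar> * (\<bar>h x\<bar> * (h x)\<^sup>2)"
          by (simp add: power3_eq_cube power2_eq_square mult.assoc)
        also have "\<dots> \<le> \<bar>t / s\<bar> * (C * (h x)\<^sup>2)"
          using h(1)[of x] by (intro mult_left_mono mult_right_mono) auto
        finally show ?thesis unfolding mult.assoc by (rule min.coboundedI2)
      qed
    qed (use int in auto)
    then show ?thesis using h by simp
  qed
  have \<psi>_eq: "\<psi> = 1 - (t / s)\<^sup>2 * \<zeta> / 2"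
    using h m by (simp add: \<psi>_def power_divide s)
  have "cmod (\<phi> - \<psi>) \<le> (t / s)\<^sup>2 / 6 * mean p (\<lambda>x. min (6 * (h x)\<^sup>2) (\<bar>t / s\<bar> * \<bar>h x\<bar> ^ 3))"
    unfolding \<phi>_def \<psi>_eq by (rule prob_space.char_approx3'[OF measure_pmf.prob_space_axioms _ int h(2) var refl]) simp
  also have "\<dots> \<le> (t / s)\<^sup>2 / 6 * (\<bar>t / s\<bar> * C * \<zeta>)"
    by (intro mult_left_mono min) auto
  also have "(t / s)\<^sup>2 = t\<^sup>2 / (real m * \<zeta>)" by (simp add: power_divide s)
  also have "t\<^sup>2 / (real m * \<zeta>) / 6 * (\<bar>t / s\<bar> * C * \<zeta>) = \<bar>t\<bar> ^ 3 * C / (6 * s) / real m"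
    using s h m by (simp add: abs_divide power3_eq_cube power2_eq_square field_simps flip: abs_mult)
  finally have step: "cmod (\<phi> - \<psi>) \<le> \<bar>t\<bar> ^ 3 * C / (6 * s) / real m" .
  interpret \<mu>: real_distribution "distr (measure_pmf p) borel h"
    by (rule prob_space.real_distribution_distr[OF measure_pmf.prob_space_axioms]) simp
  have "cmod (\<phi> ^ m - \<psi> ^ m) \<le> real m * cmod (\<phi> - \<psi>)"
  proof (rule norm_power_diff)
    show "cmod \<phi> \<le> 1" unfolding \<phi>_def by (rule \<mu>.cmod_char_le_1)
    \<comment> \<open>here the lower bound on the number of summands enters\<close>
    have "\<bar>1 + (-(t\<^sup>2) / 2) / m\<bar> \<le> 1" using I(3) m by (auto simp: abs_le_iff field_simps m_def)
    then show "cmod \<psi> \<le> 1" unfolding \<psi>_def norm_of_real .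
  qed
  also have "\<dots> \<le> real m * (\<bar>t\<bar> ^ 3 * C / (6 * s) / real m)"
    by (intro mult_left_mono step) auto
  finally show ?thesis
    using m eq unfolding \<psi>_def s_def m_def by simp
qed

text \<open>
  The function $x \mapsto e^{itx}$ is $|t|$-Lipschitz, and the $L^1$ distance is at most the $L^2$
  distance. This takes the place of Slutsky's theorem.
\<close>

lemma char_distr_dist_le:
  assumes "bdd Z" "bdd W"
  shows "cmod (char (distr (measure_pmf P) borel Z) t - char (distr (measure_pmf P) borel W) t)
    \<le> \<bar>t\<bar> * sqrt (mean P (\<lambda>x. (Z x - W x)\<^sup>2))"
proof -
  have lip: "cmod (iexp a - iexp b) \<le> \<bar>a - b\<bar>" for a b :: real
  proof -
    have "iexp a - iexp b = iexp b * (iexp (a - b) - 1)"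
      by (simp add: algebra_simps flip: exp_add)
    then show ?thesis
      using iexp_approx1[of "a - b" 0] by (simp add: norm_mult)
  qed
  define D where "D x = \<bar>Z x - W x\<bar>" for x
  have int: "integrable (measure_pmf P) D" "integrable (measure_pmf P) (\<lambda>x. (D x)\<^sup>2)"
  proof -
    have "bdd (\<lambda>x. Z x - W x)" by (intro bdd_diff assms)
    then have "bdd D" by (simp add: D_def bdd_def)
    then show "integrable (measure_pmf P) D" "integrable (measure_pmf P) (\<lambda>x. (D x)\<^sup>2)"
      by (auto intro: integrable_bdd bdd_power)
  qed
  have "(mean P D)\<^sup>2 \<le> mean P (\<lambda>x. (D x)\<^sup>2)"
    using measure_pmf.variance_eq[OF int] measure_pmf.variance_positive[of P D] by simp
  then have CS: "mean P D \<le> sqrt (mean P (\<lambda>x. (D x)\<^sup>2))"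
    by (rule real_le_rsqrt)
  have iexp: "integrable (measure_pmf P) (\<lambda>x. iexp (t * f x))" for f
    by (intro measure_pmf.integrable_const_bound[of _ 1]) auto
  have "char (distr (measure_pmf P) borel Z) t - char (distr (measure_pmf P) borel W) t
      = (\<integral>x. iexp (t * Z x) - iexp (t * W x) \<partial>measure_pmf P)"
    using iexp by (simp add: char_def integral_distr)
  also have "cmod \<dots> \<le> (\<integral>x. cmod (iexp (t * Z x) - iexp (t * W x)) \<partial>measure_pmf P)"
    by (rule integral_norm_bound)
  also have "\<dots> \<le> mean P (\<lambda>x. \<bar>t\<bar> * D x)"
  proof (intro integral_mono)
    show "cmod (iexp (t * Z x) - iexp (t * W x)) \<le> \<bar>t\<bar> * D x" for x
      using lip[of "t * Z x" "t * W x"] by (simp add: D_def abs_mult flip: right_diff_distrib)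
  qed (use int iexp in auto)
  also have "\<dots> = \<bar>t\<bar> * mean P D" by simp
  also have "\<dots> \<le> \<bar>t\<bar> * sqrt (mean P (\<lambda>x. (D x)\<^sup>2))"
    by (intro mult_left_mono CS) auto
  finally show ?thesis by (simp add: D_def)
qed

text \<open>
  Write $A$ and $E$ for the second moments of $L$ and $R$. By orthogonality the variance of $L + R$
  is $A + E$, and both standardised variables have norm $1$ and inner product $\sqrt{\rho}$ with $\rho = A / (A + E)$. Their
  squared distance is therefore $2 - 2 \sqrt{\rho} \le 2 (1 - \rho) \le 2 E / A$.
\<close>

lemma standardization_distance:
  assumes "bdd L" "bdd R" "mean P L = 0" "mean P R = 0" "mean P (\<lambda>x. L x * R x) = 0"
    and pos: "mean P (\<lambda>x. (L x)\<^sup>2) > 0"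
  shows "mean P (\<lambda>x. (standardized (measure_pmf P) (\<lambda>x. a + L x + R x) x - L x / sqrt (mean P (\<lambda>x. (L x)\<^sup>2)))\<^sup>2)
    \<le> 2 * (mean P (\<lambda>x. (R x)\<^sup>2) / mean P (\<lambda>x. (L x)\<^sup>2))"
proof -
  note [simp] = integrable_bdd bdd_const bdd_add bdd_mult bdd_power assms(1-5)
  define A where "A = mean P (\<lambda>x. (L x)\<^sup>2)"
  define E where "E = mean P (\<lambda>x. (R x)\<^sup>2)"
  have A: "A > 0" using pos by (simp add: A_def)
  have E: "E \<ge> 0" by (simp add: E_def)
  have quad: "mean P (\<lambda>x. (u * L x + v * R x)\<^sup>2) = u\<^sup>2 * A + v\<^sup>2 * E" for u v
  proof -
    have "(\<lambda>x. (u * L x + v * R x)\<^sup>2) = (\<lambda>x. u\<^sup>2 * (L x)\<^sup>2 + v\<^sup>2 * (R x)\<^sup>2 + 2 * u * v * (L x * R x))"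
      by (simp add: power2_sum power_mult_distrib algebra_simps)
    then show ?thesis by (simp add: A_def E_def)
  qed
  have mean_U: "mean P (\<lambda>x. a + L x + R x) = a" by simp
  have var: "measure_pmf.variance P (\<lambda>x. a + L x + R x) = A + E"
    using quad[of 1 1] unfolding mean_U by (simp add: algebra_simps)
  define u where "u = 1 / sqrt (A + E) - 1 / sqrt A"
  define v where "v = 1 / sqrt (A + E)"
  define \<rho> where "\<rho> = A / (A + E)"
  have "standardized (measure_pmf P) (\<lambda>x. a + L x + R x) x - L x / sqrt A = u * L x + v * R x" for x
    unfolding standardized_def var unfolding mean_U u_def v_def by (simp add: algebra_simps add_divide_distrib)
  then have "mean P (\<lambda>x. (standardized (measure_pmf P) (\<lambda>x. a + L x + R x) x - L x / sqrt A)\<^sup>2) = u\<^sup>2 * A + v\<^sup>2 * E"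
    by (simp only: quad)
  also have "\<dots> = 2 - 2 * sqrt \<rho>"
  proof -
    have 1: "v\<^sup>2 * (A + E) = 1" using A E by (simp add: v_def power_divide)
    have 2: "1 / sqrt A * A = sqrt A" using A by (simp add: real_div_sqrt)
    have 3: "(1 / sqrt A)\<^sup>2 * A = 1" using A by (simp add: power_divide)
    have "u\<^sup>2 * A + v\<^sup>2 * E = v\<^sup>2 * (A + E) + (1 / sqrt A)\<^sup>2 * A - 2 * v * (1 / sqrt A * A)"
      unfolding u_def v_def by (simp add: power2_diff algebra_simps)
    also have "\<dots> = 2 - 2 * (v * sqrt A)" unfolding 1 2 3 by simp
    also have "v * sqrt A = sqrt \<rho>" by (simp add: v_def \<rho>_def real_sqrt_divide)
    finally show ?thesis .
  qed
  also have "\<dots> \<le> 2 - 2 * \<rho>"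
  proof -
    have "0 \<le> \<rho>" "\<rho> \<le> 1" using A E by (auto simp: \<rho>_def)
    then have "\<rho> \<le> sqrt \<rho>" by (intro real_le_rsqrt) (simp add: power2_eq_square mult_left_le)
    then show ?thesis by simp
  qed
  also have "\<dots> = 2 * (E / (A + E))"
    using A E by (simp add: \<rho>_def field_simps)
  also have "\<dots> \<le> 2 * (E / A)"
    using A E by (intro mult_left_mono divide_left_mono) auto
  finally show ?thesis by (simp add: A_def E_def)
qed

text \<open>
  Hoeffding's theorem for triangular arrays: the law of the observations may change with the sample
  size, provided that the variance of the first projection stays away from $0$.
\<close>

theorem U_statistic_clt:
  fixes p :: "nat \<Rightarrow> 'a pmf" and k :: "'a multiset \<Rightarrow> real" and B c :: real and q :: nat and d :: 'a
  assumes k: "\<And>M. \<bar>k M\<bar> \<le> B" and c: "c > 0"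
    and nondegenerate: "\<And>m. c \<le> mean (p m) (\<lambda>x. (hajek (p m) k q x)\<^sup>2)"
  defines "P \<equiv> \<lambda>m. Pi_pmf {1..m::nat} d (\<lambda>_. p m)"
  shows "weak_conv_m (\<lambda>m. distr (measure_pmf (P m)) borel (standardized (measure_pmf (P m)) (U_sum k (Suc q) {1..m})))
    std_normal_distribution"
proof (rule levy_continuity)
  show "real_distribution (distr (measure_pmf (P m)) borel (standardized (measure_pmf (P m)) (U_sum k (Suc q) {1..m})))" for m
    by (rule prob_space.real_distribution_distr[OF measure_pmf.prob_space_axioms]) simp
  show "real_distribution std_normal_distribution" by (rule real_dist_normal_dist)
  fix t :: real
  define Z where "Z m = standardized (measure_pmf (P m)) (U_sum k (Suc q) {1..m})" for m
  define \<nu> where "\<nu> m = mean (p m) (\<lambda>x. (hajek (p m) k q x)\<^sup>2)" for m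
  \<comment> \<open>the standardised linear part\<close>
  define W where "W m x = (\<Sum>i\<in>{1..m}. hajek (p m) k q (x i)) / sqrt (real m * \<nu> m)" for m x
  define K where "K = (2 * B * (q + 2) * q)\<^sup>2 / 2 / c"
  have B: "B \<ge> 0" using k[of "{#}"] by linarith
  have \<nu>: "c \<le> \<nu> m" "0 < \<nu> m" for m
    using nondegenerate[of m] c by (auto simp: \<nu>_def)
  have bk: "bdd k" using k by (rule bddI)

  \<comment> \<open>from this sample size on, the binomial coefficient in the linear part is positive and m - 1 > 0\<close>
  have ZW: "cmod (char (distr (measure_pmf (P m)) borel (Z m)) t - char (distr (measure_pmf (P m)) borel (W m)) t)
      \<le> \<bar>t\<bar> * sqrt (2 * (K / (real m - 1)))" if m: "m \<ge> q + 2" for m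
  proof -
    interpret bounded_kernel "p m" k B q "{1..m}" d
      by standard (use k in auto)
    define A where "A = (real ((m - 1) choose q))\<^sup>2 * m"
    have A: "A > 0" using m by (simp add: A_def)
    have LL: "mean (P m) (\<lambda>x. (L x)\<^sup>2) = A * \<nu> m"
      using mean_L_squared unfolding P_def A_def \<nu>_def \<zeta>_def by simp
    have "W m x = L x / sqrt (mean (P m) (\<lambda>x. (L x)\<^sup>2))" for x
      using m unfolding LL unfolding L_def W_def A_def by (simp add: real_sqrt_mult)
    then have W: "W m = (\<lambda>x. L x / sqrt (mean (P m) (\<lambda>x. (L x)\<^sup>2)))" ..
    have U: "U_sum k (Suc q) {1..m} = (\<lambda>x. \<theta> + L x + R x)"
      using U_sum_eq ..
    have "mean (P m) (\<lambda>x. (R x)\<^sup>2) \<le> (2 * B * (q + 2) * q)\<^sup>2 / (2 * (real m - 1)) * A"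
      using mean_R_squared m unfolding P_def A_def by simp
    also have "\<dots> = K / (real m - 1) * (c * A)"
      using c by (simp add: K_def)
    also have "\<dots> \<le> K / (real m - 1) * (\<nu> m * A)"
      using m c A \<nu>[of m] by (intro mult_left_mono mult_right_mono) (auto simp: K_def)
    finally have RL: "mean (P m) (\<lambda>x. (R x)\<^sup>2) / mean (P m) (\<lambda>x. (L x)\<^sup>2) \<le> K / (real m - 1)"
      using A \<nu>[of m] unfolding LL by (simp add: divide_le_eq mult.commute)
    have "mean (P m) (\<lambda>x. (Z m x - W m x)\<^sup>2) \<le> 2 * (mean (P m) (\<lambda>x. (R x)\<^sup>2) / mean (P m) (\<lambda>x. (L x)\<^sup>2))"
      unfolding Z_def W U
      by (rule standardization_distance)
        (use bdd_L bdd_R mean_L mean_R mean_R_L LL A \<nu>[of m] in \<open>auto simp: P_def\<close>)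
    also have "\<dots> \<le> 2 * (K / (real m - 1))"
      by (intro mult_left_mono RL) auto
    finally have "sqrt (mean (P m) (\<lambda>x. (Z m x - W m x)\<^sup>2)) \<le> sqrt (2 * (K / (real m - 1)))"
      by simp
    moreover have "bdd (Z m)" "bdd (W m)"
    proof -
      show "bdd (Z m)"
        unfolding Z_def U standardized_def by (intro bdd_intros bdd_L bdd_R)
      show "bdd (W m)"
        unfolding W by (intro bdd_intros bdd_L)
    qed
    ultimately show ?thesis
      by (intro order.trans[OF char_distr_dist_le] mult_left_mono) auto
  qed
  have WN: "cmod (char (distr (measure_pmf (P m)) borel (W m)) t - complex_of_real ((1 + (-(t\<^sup>2) / 2) / real m) ^ m))
      \<le> \<bar>t\<bar> ^ 3 * (2 * B) / (6 * sqrt (real m * c))" if m: "m \<ge> 1" "t\<^sup>2 / 4 \<le> real m" for m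
  proof -
    have "cmod (char (distr (measure_pmf (P m)) borel (W m)) t - complex_of_real ((1 + (-(t\<^sup>2) / 2) / real m) ^ m))
      \<le> \<bar>t\<bar> ^ 3 * (2 * B) / (6 * sqrt (real m * \<nu> m))"
      using char_iid_sum_bound[where h = "hajek (p m) k q" and p = "p m" and C = "2 * B" and \<zeta> = "\<nu> m"
          and I = "{1..m}" and t = t and d = d, OF abs_hajek_le[where k = k, OF k] mean_hajek[OF bk]
          \<nu>_def[symmetric] \<nu>(2)] m
      unfolding P_def W_def[abs_def] by simp
    also have "\<dots> \<le> \<bar>t\<bar> ^ 3 * (2 * B) / (6 * sqrt (real m * c))"
      using B c \<nu>[of m] m by (intro divide_left_mono) (auto intro!: mult_pos_pos)
    finally show ?thesis .
  qed
  have "(\<lambda>m. char (distr (measure_pmf (P m)) borel (Z m)) t - complex_of_real ((1 + (-(t\<^sup>2) / 2) / real m) ^ m)) \<longlonglongrightarrow> 0"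
  proof (rule Lim_null_comparison)
    show "\<forall>\<^sub>F m in sequentially. cmod (char (distr (measure_pmf (P m)) borel (Z m)) t - complex_of_real ((1 + (-(t\<^sup>2) / 2) / real m) ^ m))
      \<le> \<bar>t\<bar> * sqrt (2 * (K / (real m - 1))) + \<bar>t\<bar> ^ 3 * (2 * B) / (6 * sqrt (real m * c))"
      using eventually_ge_at_top[of "q + 2"] eventually_ge_at_top[of "nat \<lceil>t\<^sup>2 / 4\<rceil>"]
    proof eventually_elim
      case (elim m)
      then have "t\<^sup>2 / 4 \<le> real m" by linarith
      then show ?case
        using norm_triangle_mono[OF ZW[of m] WN[of m]] elim by simp
    qed
    have "(\<lambda>m. \<bar>t\<bar> * sqrt (2 * (K / (real m - 1)))) \<longlonglongrightarrow> \<bar>t\<bar> * sqrt (2 * 0)"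
    proof (intro tendsto_intros)
      show "(\<lambda>m. K / (real m - 1)) \<longlonglongrightarrow> 0"
        by real_asymp
    qed
    moreover have "(\<lambda>m. \<bar>t\<bar> ^ 3 * (2 * B) / (6 * sqrt (real m * c))) \<longlonglongrightarrow> 0"
      using c by real_asymp
    ultimately show "(\<lambda>m. \<bar>t\<bar> * sqrt (2 * (K / (real m - 1))) + \<bar>t\<bar> ^ 3 * (2 * B) / (6 * sqrt (real m * c))) \<longlonglongrightarrow> 0"
      using tendsto_add by fastforce
  qed
  moreover have "(\<lambda>m. complex_of_real ((1 + (-(t\<^sup>2) / 2) / real m) ^ m)) \<longlonglongrightarrow> complex_of_real (exp (-(t\<^sup>2) / 2))"
    by (rule isCont_tendsto_compose[OF _ tendsto_exp_limit_sequentially]) auto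
  ultimately have "(\<lambda>m. char (distr (measure_pmf (P m)) borel (Z m)) t) \<longlonglongrightarrow> complex_of_real (exp (-(t\<^sup>2) / 2))"
    by (rule Lim_transform[rotated])
  then show "(\<lambda>m. char (distr (measure_pmf (P m)) borel (standardized (measure_pmf (P m)) (U_sum k (Suc q) {1..m}))) t)
      \<longlonglongrightarrow> char std_normal_distribution t"
    by (simp add: Z_def char_std_normal_distribution)
qed

section \<open>Non-degeneracy of the coprimality kernel\<close>

definition coprime_kernel :: "nat multiset \<Rightarrow> real" where
  "coprime_kernel M = of_bool (Gcd (set_mset M) = 1)"

abbreviation (input) "unif n \<equiv> pmf_of_set {1..n::nat}"

lemma mean_unif: "n \<ge> 1 \<Longrightarrow> mean (unif n) f = (\<Sum>x\<in>{1..n}. f x) / n"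
  by (subst integral_pmf_of_set) auto

text \<open>
  The first term is $1/4$, and the others are dominated by the telescoping sum of
  $1 / ((d-1) d)$ over $d \ge 3$, which is at most $1/2$. The induction carries the tail $1/N$.
\<close>

lemma sum_inverse_squares_le: "(\<Sum>d\<in>{2..N}. 1 / (real d)\<^sup>2) \<le> 3 / 4"
proof -
  have *: "(\<Sum>d\<in>{2..N}. 1 / (real d)\<^sup>2) \<le> 3 / 4 - 1 / real N" if "N \<ge> 2" for N
    using that
  proof (induction N rule: dec_induct)
    case (step N)
    have "1 / (real (Suc N))\<^sup>2 \<le> 1 / (real N * real (Suc N))"
      using step.hyps by (intro divide_left_mono) (auto simp: power2_eq_square)
    also have "\<dots> = 1 / real N - 1 / real (Suc N)"
      using step.hyps by (simp add: field_simps)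
    finally show ?case using step by simp
  qed simp
  show ?thesis
  proof (cases "N \<ge> 2")
    case True
    then show ?thesis using *[OF True] by (smt (verit) divide_nonneg_nonneg of_nat_0_le_iff)
  qed simp
qed

text \<open>
  A pair that is not coprime has a common divisor $d \ge 2$, and there are at most $(N/d)^2$ pairs
  divisible by $d$. By \<open>sum_inverse_squares_le\<close> this leaves at least a quarter of all pairs.
\<close>

lemma card_coprime_pairs: "(real N)\<^sup>2 / 4 \<le> card {(a, b). a \<in> {1..N} \<and> b \<in> {1..N} \<and> coprime a b}"
proof -
  let ?C = "{(a, b). a \<in> {1..N} \<and> b \<in> {1..N} \<and> coprime a b}"
  let ?m = "\<lambda>d. {a \<in> {1..N}. d dvd a}"
  have fin: "finite ?C"
    by (rule finite_subset[of _ "{1..N} \<times> {1..N}"]) auto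
  have "{1..N} \<times> {1..N} \<subseteq> ?C \<union> (\<Union>d\<in>{2..N}. ?m d \<times> ?m d)"
  proof
    fix z assume z: "z \<in> {1..N} \<times> {1..N}"
    obtain a b where [simp]: "z = (a, b)" by fastforce
    show "z \<in> ?C \<union> (\<Union>d\<in>{2..N}. ?m d \<times> ?m d)"
    proof (cases "coprime a b")
      case False
      have ab: "1 \<le> a" "a \<le> N" "1 \<le> b" "b \<le> N" "\<not> coprime a b" using z False by auto
      have "gcd a b \<noteq> 1" using ab by (simp add: coprime_iff_gcd_eq_1)
      moreover have "gcd a b > 0" using ab by simp
      moreover have "gcd a b \<le> a" using ab by (intro dvd_imp_le) auto
      ultimately have "gcd a b \<in> {2..N}" using ab(2) unfolding atLeastAtMost_iff by linarith
      moreover have "z \<in> ?m (gcd a b) \<times> ?m (gcd a b)" using ab by simp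
      ultimately show ?thesis by blast
    qed (use z in auto)
  qed
  then have "card ({1..N} \<times> {1..N}) \<le> card (?C \<union> (\<Union>d\<in>{2..N}. ?m d \<times> ?m d))"
    using fin by (intro card_mono) auto
  also have "\<dots> \<le> card ?C + card (\<Union>d\<in>{2..N}. ?m d \<times> ?m d)"
    by (rule card_Un_le)
  also have "card (\<Union>d\<in>{2..N}. ?m d \<times> ?m d) \<le> (\<Sum>d\<in>{2..N}. card (?m d \<times> ?m d))"
    by (rule card_UN_le) simp
  finally have "N * N \<le> card ?C + (\<Sum>d\<in>{2..N}. card (?m d) * card (?m d))"
    by (simp add: card_cartesian_product)
  then have "real (N * N) \<le> real (card ?C + (\<Sum>d\<in>{2..N}. card (?m d) * card (?m d)))"
    by (rule of_nat_mono)
  then have "(real N)\<^sup>2 \<le> card ?C + (\<Sum>d\<in>{2..N}. (real (card (?m d)))\<^sup>2)"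
    by (simp add: power2_eq_square)
  also have "(\<Sum>d\<in>{2..N}. (real (card (?m d)))\<^sup>2) \<le> (\<Sum>d\<in>{2..N}. (real N)\<^sup>2 * (1 / (real d)\<^sup>2))"
  proof (intro sum_mono)
    fix d assume d: "d \<in> {2..N}"
    have "?m d \<subseteq> (\<lambda>j. d * j) ` {1..N div d}"
    proof
      fix a assume a: "a \<in> ?m d"
      then obtain j where j: "a = d * j" by (auto elim: dvdE)
      with a d have "j \<in> {1..N div d}" by (auto simp: less_eq_div_iff_mult_less_eq mult.commute)
      with j show "a \<in> (\<lambda>j. d * j) ` {1..N div d}" by blast
    qed
    then have "card (?m d) \<le> N div d"
      using surj_card_le[of "{1..N div d}"] by auto
    then have "real (card (?m d)) \<le> real N / real d"
      using of_nat_div_le_of_nat[of N d, where ?'a = real] by linarith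
    then have "(real (card (?m d)))\<^sup>2 \<le> (real N / real d)\<^sup>2"
      by (intro power_mono) auto
    then show "(real (card (?m d)))\<^sup>2 \<le> (real N)\<^sup>2 * (1 / (real d)\<^sup>2)"
      by (simp add: power_divide)
  qed
  also have "\<dots> = (real N)\<^sup>2 * (\<Sum>d\<in>{2..N}. 1 / (real d)\<^sup>2)"
    by (simp only: sum_distrib_left)
  also have "\<dots> \<le> (real N)\<^sup>2 * (3 / 4)"
    by (intro mult_left_mono sum_inverse_squares_le) auto
  finally show ?thesis by simp
qed

text \<open>
  The worst case is $n = 3$.
\<close>

lemma third_le_half: "n \<ge> 2 \<Longrightarrow> real n / 3 \<le> real (n div 2)"
proof -
  assume "n \<ge> 2"
  then have "n \<le> 3 * (n div 2)" by presburger
  then have "real n \<le> real (3 * (n div 2))" by (rule of_nat_mono)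
  then show ?thesis by simp
qed

text \<open>
  Doubling maps coprime pairs up to $\lfloor n/2 \rfloor \ge n/3$ to pairs up to $n$ with gcd $2$, so the
  probability is at least $\frac14 \cdot (\frac13)^2$.
\<close>

lemma mean_gcd_eq_2:
  assumes n: "n \<ge> 2"
  shows "mean (unif n) (\<lambda>a. mean (unif n) (\<lambda>b. of_bool (gcd a b = 2))) \<ge> 1 / 36"
proof -
  let ?N = "n div 2"
  let ?C = "{(a, b). a \<in> {1..?N} \<and> b \<in> {1..?N} \<and> coprime a b}"
  let ?G = "{(a, b). a \<in> {1..n} \<and> b \<in> {1..n} \<and> gcd a b = 2}"
  have fin: "finite ?G"
    by (rule finite_subset[of _ "{1..n} \<times> {1..n}"]) auto
  have "card ?C = card ((\<lambda>(a, b). (2 * a, 2 * b)) ` ?C)"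
    by (rule card_image[symmetric]) (auto simp: inj_on_def)
  also have "\<dots> \<le> card ?G"
    using fin by (intro card_mono) (auto simp: gcd_mult_distrib_nat[symmetric] coprime_iff_gcd_eq_1)
  finally have CG: "card ?C \<le> card ?G" .
  have "(real n)\<^sup>2 / 36 = (real n / 3)\<^sup>2 / 4" by (simp add: power2_eq_square)
  also have "\<dots> \<le> (real ?N)\<^sup>2 / 4"
    using third_le_half[OF n] by (intro divide_right_mono power_mono) auto
  also have "\<dots> \<le> card ?G" using card_coprime_pairs[of ?N] CG by linarith
  also have "real (card ?G) = (\<Sum>(a, b)\<in>{1..n} \<times> {1..n}. of_bool (gcd a b = 2))"
  proof -
    have "?G = {z \<in> {1..n} \<times> {1..n}. gcd (fst z) (snd z) = 2}" by auto
    then show ?thesis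
      by (simp only: real_of_card sum.inter_filter finite_cartesian_product finite_atLeastAtMost)
        (simp add: of_bool_def case_prod_unfold)
  qed
  also have "\<dots> = (\<Sum>a\<in>{1..n}. \<Sum>b\<in>{1..n}. of_bool (gcd a b = 2))"
    by (rule sum.cartesian_product[symmetric])
  finally have "(real n)\<^sup>2 / 36 / (real n)\<^sup>2 \<le> (\<Sum>a\<in>{1..n}. \<Sum>b\<in>{1..n}. of_bool (gcd a b = 2)) / (real n)\<^sup>2"
    by (rule divide_right_mono) simp
  then show ?thesis
    using n mean_unif[of n] by (simp add: power2_eq_square flip: sum_divide_distrib)
qed

lemma mean_all_even:
  assumes n: "n \<ge> 2"
  shows "mean (draws (unif n) j) (\<lambda>M. of_bool (\<forall>x\<in>#M. even x)) \<ge> (1 / 3) ^ j"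
proof (induction j)
  case (Suc j)
  let ?e = "\<lambda>M. of_bool (\<forall>x\<in>#M. even x) :: real"
  have be: "bdd ?e" by (rule bddI[of _ 1]) auto
  have "1 / 3 \<le> mean (unif n) (\<lambda>x. of_bool (even x))"
  proof -
    have "real (n div 2) = card ((\<lambda>j. 2 * j) ` {1..n div 2})"
      by (subst card_image) (auto simp: inj_on_def)
    also have "\<dots> \<le> card {x \<in> {1..n}. even x}"
      by (intro of_nat_mono card_mono) auto
    also have "real (card {x \<in> {1..n}. even x}) = (\<Sum>x\<in>{1..n}. of_bool (even x))"
      by (simp add: of_bool_def sum.If_cases Int_def)
    finally have "real n / 3 \<le> (\<Sum>x\<in>{1..n}. of_bool (even x))" using third_le_half[OF n] by linarith
    then have "1 / 3 \<le> (\<Sum>x\<in>{1..n}. of_bool (even x)) / real n" using n by (simp add: le_divide_eq)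
    then show ?thesis using n mean_unif[of n] by simp
  qed
  then have "(1 / 3) ^ Suc j \<le> mean (unif n) (\<lambda>x. of_bool (even x)) * mean (draws (unif n) j) ?e"
    unfolding power_Suc using Suc.IH by (intro mult_mono) auto
  also have "\<dots> = mean (draws (unif n) (Suc j)) ?e"
    unfolding mean_draws_Suc[OF be] by (simp add: of_bool_conj flip: integral_mult_left_zero)
  finally show ?case .
qed simp

text \<open>
  It suffices that the first two draws have gcd $2$ and the other $j$ draws are even. These events are
  independent.
\<close>

lemma mean_Gcd_draws_eq_2:
  assumes n: "n \<ge> 2"
  shows "mean (draws (unif n) (Suc (Suc j))) (\<lambda>M. of_bool (Gcd (set_mset M) = 2)) \<ge> (1 / 3) ^ j / 36"
proof -
  let ?u = "unif n"
  let ?g = "\<lambda>a b. of_bool (gcd a b = (2::nat)) :: real"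
  let ?e = "\<lambda>M. of_bool (\<forall>x\<in>#M. even x) :: real"
  let ?f = "\<lambda>M. of_bool (Gcd (set_mset M) = 2) :: real"
  have b: "bdd ?f" by (rule bddI[of _ 1]) auto
  have b2: "bdd (\<lambda>M. ?f (add_mset a M))" for a by (rule bdd_compose[OF b])
  have pt: "?g a b * ?e M \<le> ?f (add_mset a (add_mset b M))" for a b and M :: "nat multiset"
  proof (cases "gcd a b = 2 \<and> (\<forall>x\<in>#M. even x)")
    case True
    then have "2 dvd Gcd (set_mset M)" by (auto intro: Gcd_greatest)
    then have "gcd (gcd a b) (Gcd (set_mset M)) = 2" using True by (simp add: gcd_proj1_iff)
    then show ?thesis by (simp add: gcd.assoc)
  qed auto
  have fin: "finite (set_pmf ?u)" using n by simp
  have 1: "mean ?u (\<lambda>a. mean ?u (\<lambda>b. ?g a b * mean (draws ?u j) ?e)) \<le>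
    mean ?u (\<lambda>a. mean ?u (\<lambda>b. mean (draws ?u j) (\<lambda>M. ?f (add_mset a (add_mset b M)))))"
  proof (intro integral_mono integrable_measure_pmf_finite fin)
    fix a b
    have "?g a b * mean (draws ?u j) ?e = mean (draws ?u j) (\<lambda>M. ?g a b * ?e M)" by simp
    also have "\<dots> \<le> mean (draws ?u j) (\<lambda>M. ?f (add_mset a (add_mset b M)))"
      by (intro integral_mono pt integrable_bdd bddI[of _ 1]) auto
    finally show "?g a b * mean (draws ?u j) ?e \<le> \<dots>" .
  qed
  have "(1 / 3) ^ j / 36 = 1 / 36 * (1 / 3 :: real) ^ j" by simp
  also have "\<dots> \<le> mean ?u (\<lambda>a. mean ?u (?g a)) * mean (draws ?u j) ?e"
    by (intro mult_mono mean_gcd_eq_2 mean_all_even n) auto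
  also have "\<dots> = mean ?u (\<lambda>a. mean ?u (\<lambda>b. ?g a b * mean (draws ?u j) ?e))" by simp
  also note 1
  finally show ?thesis
    by (simp only: mean_draws_Suc[OF b] mean_draws_Suc[OF b2])
qed

text \<open>
  Doubling an entry can only destroy coprimality, and it does so when the other entries have gcd $2$
  and $x$ is odd.
\<close>

lemma coprime_kernel_drop:
  assumes "odd x"
  shows "coprime_kernel (add_mset x M) - coprime_kernel (add_mset (2 * x) M) \<ge> of_bool (Gcd (set_mset M) = 2)"
proof -
  have "coprime_kernel (add_mset (2 * x) M) \<le> coprime_kernel (add_mset x M)"
  proof -
    have "coprime x g" if "coprime (2 * x) g" for g using that by simp
    then show ?thesis
      by (auto simp: coprime_kernel_def simp flip: coprime_iff_gcd_eq_1 One_nat_def)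
  qed
  moreover have "coprime_kernel (add_mset x M) = 1 \<and> coprime_kernel (add_mset (2 * x) M) = 0" if "Gcd (set_mset M) = 2"
    using that assms by (auto simp: coprime_kernel_def coprime_iff_gcd_eq_1[symmetric] simp flip: One_nat_def)
  ultimately show ?thesis by auto
qed

text \<open>
  Whenever $h(x)$ and $h(2x)$ differ by at least $\delta$, their squares add up to at least
  $\delta^2 / 2$. The pairs $\{x, 2x\}$ with odd $x \le n/2$ are disjoint and there are at least $n/6$ of them,
  which yields $E\, h(X)^2 \ge \delta^2 / 12$.
\<close>

lemma coprime_hajek_nondegenerate:
  assumes n: "n \<ge> 2"
  shows "((1 / 3) ^ j / 36)\<^sup>2 / 12 \<le> mean (unif n) (\<lambda>x. (hajek (unif n) coprime_kernel (Suc (Suc j)) x)\<^sup>2)"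
proof -
  let ?h = "hajek (unif n) coprime_kernel (Suc (Suc j))"
  let ?D = "draws (unif n) (Suc (Suc j))"
  define \<delta> :: real where "\<delta> = (1 / 3) ^ j / 36"
  have b: "bdd (\<lambda>M. coprime_kernel (add_mset x M))" for x
    by (rule bddI[of _ 1]) (auto simp: coprime_kernel_def)
  have gap: "\<delta> \<le> ?h x - ?h (2 * x)" if "odd x" for x
  proof -
    have "\<delta> \<le> mean ?D (\<lambda>M. of_bool (Gcd (set_mset M) = 2))"
      unfolding \<delta>_def by (rule mean_Gcd_draws_eq_2[OF n])
    also have "\<dots> \<le> mean ?D (\<lambda>M. coprime_kernel (add_mset x M) - coprime_kernel (add_mset (2 * x) M))"
    proof (intro integral_mono coprime_kernel_drop[OF that])
      show "integrable ?D (\<lambda>M. of_bool (Gcd (set_mset M) = 2) :: real)"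
        by (intro integrable_bdd bddI[of _ 1]) auto
      show "integrable ?D (\<lambda>M. coprime_kernel (add_mset x M) - coprime_kernel (add_mset (2 * x) M))"
        by (intro integrable_bdd bdd_diff b)
    qed
    also have "\<dots> = ?h x - ?h (2 * x)"
      unfolding hajek_def by (subst Bochner_Integration.integral_diff) (use integrable_bdd[OF b] in simp_all)
    finally show ?thesis .
  qed
  \<comment> \<open>parallelogram identity\<close>
  have half: "c / 2 \<le> u\<^sup>2 + v\<^sup>2" if "c \<le> (u - v)\<^sup>2" for c u v :: real
    using that zero_le_power2[of "u + v"] unfolding power2_sum power2_diff by linarith
  have sq: "\<delta>\<^sup>2 / 2 \<le> (?h x)\<^sup>2 + (?h (2 * x))\<^sup>2" if "odd x" for x
    using gap[OF that] by (intro half power_mono) (auto simp: \<delta>_def)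
  define Q where "Q = {x \<in> {1..n div 2}. odd x}"
  have card_Q: "real n / 6 \<le> card Q"
  proof -
    \<comment> \<open>the odd numbers 2 i + 1 up to n div 2\<close>
    have "(\<lambda>i. 2 * i + 1) ` {..<(n div 2 + 1) div 2} \<subseteq> Q"
      by (auto simp: Q_def)
    moreover have "finite Q" by (simp add: Q_def)
    ultimately have "card ((\<lambda>i::nat. 2 * i + 1) ` {..<(n div 2 + 1) div 2}) \<le> card Q"
      by (intro card_mono)
    also have "card ((\<lambda>i::nat. 2 * i + 1) ` {..<(n div 2 + 1) div 2}) = (n div 2 + 1) div 2"
      by (subst card_image) (auto simp: inj_on_def)
    finally have "(n div 2 + 1) div 2 \<le> card Q" .
    moreover have "n \<le> 3 * (n div 2)" using n by presburger
    moreover have "n div 2 \<le> 2 * ((n div 2 + 1) div 2)"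
      by presburger
    ultimately have "n \<le> 6 * card Q" by linarith
    then have "real n \<le> real (6 * card Q)" by (rule of_nat_mono)
    then show ?thesis by simp
  qed
  have "real n / 6 * (\<delta>\<^sup>2 / 2) \<le> real (card Q) * (\<delta>\<^sup>2 / 2)"
    by (intro mult_right_mono card_Q) auto
  also have "\<dots> \<le> (\<Sum>x\<in>Q. (?h x)\<^sup>2 + (?h (2 * x))\<^sup>2)"
    using sum_mono[of Q "\<lambda>_. \<delta>\<^sup>2 / 2"] sq by (simp add: Q_def)
  also have "\<dots> = (\<Sum>x\<in>Q. (?h x)\<^sup>2) + (\<Sum>x\<in>(\<lambda>x. 2 * x) ` Q. (?h x)\<^sup>2)"
    by (simp add: sum.distrib sum.reindex inj_on_def)
  also have "\<dots> = (\<Sum>x\<in>Q \<union> (\<lambda>x. 2 * x) ` Q. (?h x)\<^sup>2)"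
    by (subst sum.union_disjoint) (auto simp: Q_def)
  also have "\<dots> \<le> (\<Sum>x\<in>{1..n}. (?h x)\<^sup>2)"
    by (intro sum_mono2) (auto simp: Q_def)
  finally have "\<delta>\<^sup>2 / 12 \<le> (\<Sum>x\<in>{1..n}. (?h x)\<^sup>2) / n"
    using n by (simp add: field_simps)
  then show ?thesis
    using n unfolding \<delta>_def by (subst mean_unif) simp_all
qed

section \<open>Coprime tuples in a random sample\<close>

text \<open>
  Finitely many independent variables with values in a countable type have a discrete joint law, the
  product of their marginal laws. The variables are extended by the default value \<open>d\<close> outside $I$,
  so the joint law lives on a countable set and is determined by the mass of each point.
\<close>

lemma (in prob_space) distr_indep_vars_eq_Pi_pmf:
  fixes X :: "'i \<Rightarrow> 'a \<Rightarrow> 'b :: countable" and d :: 'b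
  assumes I: "finite I"
    and indep: "indep_vars (\<lambda>_. count_space UNIV) X I"
    and law: "\<And>i. i \<in> I \<Longrightarrow> distr M (count_space UNIV) (X i) = measure_pmf (p i)"
  defines "\<Phi> \<equiv> \<lambda>\<omega> i. if i \<in> I then X i \<omega> else d"
  shows "\<Phi> \<in> M \<rightarrow>\<^sub>M count_space UNIV" (is ?meas)
    and "distr M (count_space UNIV) \<Phi> = measure_pmf (Pi_pmf I d p)" (is ?eq)
proof -
  define \<Omega> where "\<Omega> = PiE_dflt I d (\<lambda>_. UNIV :: 'b set)"
  have "countable (PiE I (\<lambda>_. UNIV :: 'b set))"
    using I by (intro countable_PiE) auto
  then have countable: "countable \<Omega>"
    unfolding \<Omega>_def dflt_image_PiE[symmetric] by (rule countable_image)
  have rv [measurable]: "X i \<in> M \<rightarrow>\<^sub>M count_space UNIV" if "i \<in> I" for i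
    using indep that by (auto simp: indep_vars_def2)
  have preimage: "\<Phi> -` {f} \<inter> space M = {\<omega> \<in> space M. \<forall>i\<in>I. X i \<omega> = f i}" if "f \<in> \<Omega>" for f
    using that by (auto simp: \<Phi>_def \<Omega>_def PiE_dflt_def fun_eq_iff split: if_splits)
  have sets: "{\<omega> \<in> space M. \<forall>i\<in>I. X i \<omega> = f i} \<in> sets M" for f
    using I by (intro sets.sets_Collect_finite_All) measurable
  have "\<Phi> \<in> M \<rightarrow>\<^sub>M count_space \<Omega>"
    unfolding measurable_count_space_eq_countable[OF countable]
    using sets by (auto simp: preimage) (auto simp: \<Phi>_def \<Omega>_def PiE_dflt_def)
  then show meas: ?meas
    by (rule measurable_compose) simp
  show ?eq
  proof (rule measure_eqI_countable_AE[OF _ _ _ _ countable])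
    show "AE x in distr M (count_space UNIV) \<Phi>. x \<in> \<Omega>"
      using meas by (subst AE_distr_iff) (auto simp: \<Phi>_def \<Omega>_def PiE_dflt_def)
    show "AE x in measure_pmf (Pi_pmf I d p). x \<in> \<Omega>"
      using set_Pi_pmf_subset'[OF I, of d p] by (auto simp: AE_measure_pmf_iff \<Omega>_def PiE_dflt_def)
    fix f assume f: "f \<in> \<Omega>"
    have "prob {\<omega> \<in> space M. \<forall>i\<in>I. X i \<omega> = f i} = (\<Prod>i\<in>I. pmf (p i) (f i))"
    proof (cases "I = {}")
      case False
      have "{\<omega> \<in> space M. \<forall>i\<in>I. X i \<omega> = f i} = (\<Inter>i\<in>I. X i -` {f i} \<inter> space M)"
        using False by auto
      then have "prob {\<omega> \<in> space M. \<forall>i\<in>I. X i \<omega> = f i} = (\<Prod>i\<in>I. prob (X i -` {f i} \<inter> space M))"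
        using indep_varsD_finite[OF indep False I, of "\<lambda>i. {f i}"] by simp
      also have "prob (X i -` {f i} \<inter> space M) = pmf (p i) (f i)" if "i \<in> I" for i
        using measure_distr[OF rv[OF that], of "{f i}"] law[OF that] by (simp add: pmf.rep_eq)
      then have "(\<Prod>i\<in>I. prob (X i -` {f i} \<inter> space M)) = (\<Prod>i\<in>I. pmf (p i) (f i))"
        by (intro prod.cong) auto
      finally show ?thesis .
    qed (simp add: prob_space)
    also have "\<dots> = pmf (Pi_pmf I d p) f"
      using f I by (subst pmf_Pi') (auto simp: \<Omega>_def PiE_dflt_def)
    finally show "emeasure (distr M (count_space UNIV) \<Phi>) {f} = emeasure (measure_pmf (Pi_pmf I d p)) {f}"
      using f meas by (simp add: emeasure_distr preimage emeasure_eq_measure emeasure_pmf_single)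
  qed simp_all
qed

text \<open>
  Mean and variance, hence also the standardisation, of a function of \<open>\<Phi>\<close> depend on the law of
  \<open>\<Phi>\<close> only.
\<close>

lemma distr_standardized_eq:
  assumes meas: "\<Phi> \<in> M \<rightarrow>\<^sub>M count_space UNIV"
    and law: "distr M (count_space UNIV) \<Phi> = measure_pmf P"
  shows "distr M borel (standardized M (\<lambda>\<omega>. F (\<Phi> \<omega>)))
    = distr (measure_pmf P) borel (standardized (measure_pmf P) F)"
proof -
  have int: "integral\<^sup>L M (\<lambda>\<omega>. f (\<Phi> \<omega>)) = integral\<^sup>L (measure_pmf P) f" for f :: "_ \<Rightarrow> real"
    using integral_distr[OF meas, of f] law by simp
  have "standardized M (\<lambda>\<omega>. F (\<Phi> \<omega>)) = (\<lambda>\<omega>. standardized (measure_pmf P) F (\<Phi> \<omega>))"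
    using int[of F] int[of "\<lambda>x. (F x - integral\<^sup>L (measure_pmf P) F)\<^sup>2"]
    by (simp add: standardized_def fun_eq_iff)
  then show ?thesis
    using meas by (simp add: distr_distr comp_def flip: law)
qed

lemma coprime_tuples_eq_U_sum: "coprime_tuples r m = U_sum coprime_kernel r {1..m}"
proof
  fix x :: "nat \<Rightarrow> nat"
  have "set_mset (image_mset x (mset_set S)) = x ` S" if "S \<subseteq> {1..m}" for S
    using that finite_subset[of S "{1..m}"] by simp
  then show "coprime_tuples r m x = U_sum coprime_kernel r {1..m} x"
    unfolding coprime_tuples_def U_sum_def coprime_kernel_def by (intro sum.cong refl) auto
qed

text \<open>
  This allows the observations with an index outside $\{1, \dots, m\}$ to be replaced by a default
  value.
\<close>

lemma coprime_tuples_cong: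
  assumes "\<And>i. i \<in> {1..m} \<Longrightarrow> x i = y i"
  shows "coprime_tuples r m x = coprime_tuples r m y"
proof -
  have "x ` S = y ` S" if "S \<subseteq> {1..m}" for S
    using that assms by (intro image_cong) auto
  then show ?thesis
    unfolding coprime_tuples_def by (intro sum.cong refl) auto
qed

theorem theorem5p1:
  fixes M :: "nat \<Rightarrow> 'a measure"
    and X :: "nat \<Rightarrow> nat \<Rightarrow> 'a \<Rightarrow> nat"
    and nn :: "nat \<Rightarrow> nat"
    and r :: nat
  assumes prob: "\<And>n. n \<ge> 1 \<Longrightarrow> prob_space (M n)"
    and indep: "\<And>n. n \<ge> 1 \<Longrightarrow>
          prob_space.indep_vars (M n) (\<lambda>_. count_space UNIV) (X n) {1..}"
    and unif: "\<And>n i. n \<ge> 1 \<Longrightarrow> i \<ge> 1 \<Longrightarrow>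
          distr (M n) (count_space UNIV) (X n i) = measure_pmf (pmf_of_set {1..n})"
    and r: "r \<ge> 3"
    and nn: "\<And>m. nn m \<ge> 2"
  shows "weak_conv_m
           (\<lambda>m. distr (M (nn m)) borel
                  (standardized (M (nn m)) (\<lambda>\<omega>. coprime_tuples r m (\<lambda>i. X (nn m) i \<omega>))))
           std_normal_distribution"
proof -
  \<comment> \<open>the kernel has r = j + 3 arguments; besides the fixed argument and the two draws with gcd 2 there are j further ones\<close>
  define j where "j = r - 3"
  then have j: "r = Suc (Suc (Suc j))" using r by simp
  define P where "P m = Pi_pmf {1..m} 0 (\<lambda>_. pmf_of_set {1..nn m})" for m
  have eq: "distr (M (nn m)) borel (standardized (M (nn m)) (\<lambda>\<omega>. coprime_tuples r m (\<lambda>i. X (nn m) i \<omega>)))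
    = distr (measure_pmf (P m)) borel (standardized (measure_pmf (P m)) (U_sum coprime_kernel r {1..m}))" for m
  proof -
    have n: "nn m \<ge> 1" using nn[of m] by simp
    interpret prob_space "M (nn m)" by (rule prob[OF n])
    define \<Phi> where "\<Phi> \<omega> i = (if i \<in> {1..m} then X (nn m) i \<omega> else 0)" for \<omega> i
    have "indep_vars (\<lambda>_. count_space UNIV) (X (nn m)) {1..m}"
      by (rule indep_vars_subset[OF indep[OF n]]) auto
    note law = distr_indep_vars_eq_Pi_pmf[OF _ this, of "\<lambda>_. pmf_of_set {1..nn m}" 0, folded \<Phi>_def]
    have "coprime_tuples r m (\<lambda>i. X (nn m) i \<omega>) = U_sum coprime_kernel r {1..m} (\<Phi> \<omega>)" for \<omega>
      unfolding coprime_tuples_eq_U_sum[symmetric] by (rule coprime_tuples_cong) (simp add: \<Phi>_def)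
    then show ?thesis
      using distr_standardized_eq[OF law, where F = "U_sum coprime_kernel r {1..m}"] unif[OF n]
      by (simp add: P_def)
  qed
  show ?thesis
    unfolding eq unfolding j P_def
  proof (rule U_statistic_clt)
    show "\<bar>coprime_kernel A\<bar> \<le> 1" for A by (simp add: coprime_kernel_def)
    show "0 < (((1 / 3) ^ j / 36)\<^sup>2 / 12 :: real)" by simp
    show "((1 / 3) ^ j / 36)\<^sup>2 / 12 \<le> mean (pmf_of_set {1..nn m})
        (\<lambda>x. (hajek (pmf_of_set {1..nn m}) coprime_kernel (Suc (Suc j)) x)\<^sup>2)" for m
      by (rule coprime_hajek_nondegenerate[OF nn])
  qed
qed

end
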